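(* Let $t\ge 2$ be an integer and let $T$ be a $(t-1)$-arc-transitive digraph whose vertex set is partitioned into nonempty levels $A_1,\dots,A_t$ such that each arc of $T$ leads from $A_j$ to $A_{j+1}$ for some $j\in\{1,\dots,t-1\}$. Suppose that each vertex $v\in V(T)\setminus A_1$ has in-degree at least $1$ and each vertex $v\in V(T)\setminus A_t$ has out-degree at least $1$. Let $D(T)$ be the digraph with vertex set $\mathbb{Z}\times A_1\times A_2\times\cdots\times A_t$ in which there is an arc from $(i,a_1,\dots,a_t)$ to $(i+1,b_1,\dots,b_t)$ if and only if $(a_j,b_{j+1})\in E(T)$ for each $j=1,\dots,t-1$, and there are no other arcs. Then $D(T)$ is connected and highly arc-transitive. Moreover, if for every $i=1,\dots,t-1$ the subgraph $T_i$ of $T$ induced by $A_i\cup A_{i+1}$ is connected, then $R(D(T))$ is isomorphic to the subgraph of $D(T)$ induced by the vertices $\{0,1\}\times A_1\times\cdots\times A_t$.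
   Context: A digraph $D$ consists of a vertex set $V(D)$ and an arc set $E(D)\subseteq V(D)\times V(D)$, without loops. Connected means that the underlying undirected graph is connected. For $s\ge 0$, an $s$-arc in $D$ is an $(s+1)$-tuple $(v_0,\dots,v_s)$ of vertices such that $v_{i-1}v_i\in E(D)$ for each $i=1,\dots,s$. $D$ is $s$-arc transitive if $D$ has no isolated vertices, every arc of $D$ lies on some $s$-arc (for $s\ge1$), and for any two $s$-arcs $(v_i)_{i=0}^s$, $(v_i')_{i=0}^s$ there is an automorphism $f$ of $D$ with $f(v_i)=v_i'$ for all $i$. $D$ is highly arc-transitive if it is $s$-arc transitive for every $s\ge 0$. An alternating walk in $D$ is a sequence $(v_0,\dots,v_s)$ of vertices such that, either for all even $i$ or for all odd $i$, $v_iv_{i+1}$ and $v_iv_{i-1}$ are arcs of $D$ (whenever the indices lie in $\{0,\dots,s\}$). For arcs $e,e'$, write $e\sim e'$ if there is an alternating walk whose first arc is $e$ and whose last arc is $e'$; this is an equivalence relation on $E(D)$ (the reachability relation). If $D$ is $1$-arc transitive, the digraphs formed by the arcs of one equivalence class together with their end-vertices are all isomorphic to a fixed digraph, denoted $R(D)$. *)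

theory Defs
  imports "Graph_Theory.Graph_Theory" "HOL-Library.FuncSet" "HOL-Library.Disjoint_Sets"
begin

text \<open>
  Digraphs are \<^typ>\<open>'a pair_pre_digraph\<close> (a vertex set and a set of ordered pairs of vertices),
  with \<^const>\<open>pair_loopfree_digraph\<close> for well-formedness and absence of loops; no finiteness is
  assumed.  \<^const>\<open>connected\<close>, induced subgraphs and isomorphism are those of the library,
  where \<^const>\<open>connected\<close> refers to the symmetric closure.
\<close>

section \<open>Arc-transitivity\<close>

text \<open>An automorphism is represented by its action on the vertices.\<close>

definition digraph_automorphism :: "'a pair_pre_digraph \<Rightarrow> ('a \<Rightarrow> 'a) \<Rightarrow> bool" where
  "digraph_automorphism D f \<longleftrightarrow>
     (\<exists>h. pre_digraph.digraph_isomorphism (with_proj D) h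
        \<and> app_iso h (with_proj D) = with_proj D \<and> iso_verts h = f)"

definition s_arc :: "'a pair_pre_digraph \<Rightarrow> nat \<Rightarrow> 'a list \<Rightarrow> bool" where
  "s_arc D s p \<longleftrightarrow>
     length p = s + 1 \<and> set p \<subseteq> pverts D \<and> (\<forall>i<s. (p ! i, p ! (i + 1)) \<in> parcs D)"

definition isolated_vertex :: "'a pair_pre_digraph \<Rightarrow> 'a \<Rightarrow> bool" where
  "isolated_vertex D v \<longleftrightarrow>
     v \<in> pverts D \<and> in_arcs (with_proj D) v = {} \<and> out_arcs (with_proj D) v = {}"

definition s_arc_transitive :: "'a pair_pre_digraph \<Rightarrow> nat \<Rightarrow> bool" where
  "s_arc_transitive D s \<longleftrightarrow>
     (\<forall>v. \<not> isolated_vertex D v)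
   \<and> (s \<ge> 1 \<longrightarrow> (\<forall>e\<in>parcs D. \<exists>p. s_arc D s p \<and> (\<exists>i<s. e = (p ! i, p ! (i + 1)))))
   \<and> (\<forall>p q. s_arc D s p \<longrightarrow> s_arc D s q \<longrightarrow>
        (\<exists>f. digraph_automorphism D f \<and> map f p = q))"

definition highly_arc_transitive :: "'a pair_pre_digraph \<Rightarrow> bool" where
  "highly_arc_transitive D \<longleftrightarrow> (\<forall>s. s_arc_transitive D s)"

section \<open>The reachability relation\<close>

text \<open>
  The Boolean \<open>b\<close> says whether the vertices from which both incident walk arcs emanate
  are those of even (\<open>b = True\<close>) or of odd index.  It is kept explicit because, if both \<open>(u, v)\<close>
  and \<open>(v, u)\<close> are arcs, the vertex sequence alone does not determine the arcs traversed.
\<close>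

definition alternating_walk :: "'a pair_pre_digraph \<Rightarrow> bool \<Rightarrow> 'a list \<Rightarrow> bool" where
  "alternating_walk D b p \<longleftrightarrow>
     p \<noteq> [] \<and> set p \<subseteq> pverts D
   \<and> (\<forall>i<length p. even i = b \<longrightarrow>
        (i + 1 < length p \<longrightarrow> (p ! i, p ! (i + 1)) \<in> parcs D)
      \<and> (i \<ge> 1 \<longrightarrow> (p ! i, p ! (i - 1)) \<in> parcs D))"

definition walk_arc :: "bool \<Rightarrow> 'a list \<Rightarrow> nat \<Rightarrow> 'a \<times> 'a" where
  "walk_arc b p i = (if even i = b then (p ! i, p ! (i + 1)) else (p ! (i + 1), p ! i))"

definition reachability_rel :: "'a pair_pre_digraph \<Rightarrow> ('a \<times> 'a) rel" where
  "reachability_rel D =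
     {(e, e'). \<exists>b p. alternating_walk D b p \<and> length p \<ge> 2
        \<and> walk_arc b p 0 = e \<and> walk_arc b p (length p - 2) = e'}"

definition arc_class_digraph :: "'a pair_pre_digraph \<Rightarrow> 'a \<times> 'a \<Rightarrow> 'a pair_pre_digraph" where
  "arc_class_digraph D e =
     (let C = reachability_rel D `` {e} in \<lparr>pverts = fst ` C \<union> snd ` C, parcs = C\<rparr>)"

text \<open>
  \<open>R(D)\<close> is only determined up to isomorphism; the choice of the arc is immaterial for
  1-arc-transitive \<open>D\<close>, see \<open>reachability_digraph_iso\<close> below.
\<close>

definition reachability_digraph :: "'a pair_pre_digraph \<Rightarrow> 'a pair_pre_digraph" where
  "reachability_digraph D = arc_class_digraph D (SOME e. e \<in> parcs D)"

section \<open>The digraph \<open>D(T)\<close>\<close>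

text \<open>Tuples \<open>(a\<^sub>1, \<dots>, a\<^sub>t)\<close> are extensional functions on \<open>{1..t}\<close>.\<close>

definition level_digraph ::
  "nat \<Rightarrow> (nat \<Rightarrow> 'a set) \<Rightarrow> 'a pair_pre_digraph \<Rightarrow> (int \<times> (nat \<Rightarrow> 'a)) pair_pre_digraph" where
  "level_digraph t A T =
     \<lparr>pverts = UNIV \<times> Pi\<^sub>E {1..t} A,
      parcs = {((i, a), (i + 1, b)) | i a b.
        a \<in> Pi\<^sub>E {1..t} A \<and> b \<in> Pi\<^sub>E {1..t} A \<and> (\<forall>j\<in>{1..<t}. (a j, b (j + 1)) \<in> parcs T)}\<rparr>"

section \<open>Well-definedness\<close>

lemma pair_loopfree_level_digraph: "pair_loopfree_digraph (level_digraph t A T)"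
  by unfold_locales (auto simp: level_digraph_def)

lemma digraph_automorphism_iff:
  assumes "pair_wf_digraph D"
  shows "digraph_automorphism D f \<longleftrightarrow>
    bij_betw f (pverts D) (pverts D)
    \<and> (\<forall>u\<in>pverts D. \<forall>v\<in>pverts D. (f u, f v) \<in> parcs D \<longleftrightarrow> (u, v) \<in> parcs D)"
    (is "_ \<longleftrightarrow> ?bij \<and> ?adj")
proof
  interpret D: pair_wf_digraph D by fact
  assume "digraph_automorphism D f"
  then obtain h where h: "pre_digraph.digraph_isomorphism (with_proj D) h"
    "app_iso h (with_proj D) = with_proj D" "iso_verts h = f"
    unfolding digraph_automorphism_def by blast
  have V: "f ` pverts D = pverts D"
    using h(3) arg_cong[OF h(2), of verts] by simp
  have E: "iso_arcs h ` parcs D = parcs D"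
    using arg_cong[OF h(2), of arcs] by simp
  have ht: "iso_tail h = fst" "iso_head h = snd"
    using arg_cong[OF h(2), of tail] arg_cong[OF h(2), of head] by simp_all
  have inj: "inj_on f (pverts D)"
    and arc: "\<And>a. a \<in> parcs D \<Longrightarrow> iso_arcs h a = (f (fst a), f (snd a))"
    using h(1,3) ht by (auto simp: pre_digraph.digraph_isomorphism_def prod_eq_iff)
  have ?bij using inj V by (simp add: bij_betw_def)
  moreover have ?adj
  proof (intro ballI iffI)
    fix u v assume uv: "u \<in> pverts D" "v \<in> pverts D" "(f u, f v) \<in> parcs D"
    then obtain a where a: "a \<in> parcs D" "(f u, f v) = iso_arcs h a" using E by blast
    then have "fst a = u" "snd a = v"
      using arc[OF a(1)] uv inj D.arc_fst_in_verts[OF a(1)] D.arc_snd_in_verts[OF a(1)]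
      by (auto dest: inj_onD)
    with a(1) show "(u, v) \<in> parcs D" by auto
  next
    fix u v assume uv: "(u, v) \<in> parcs D"
    then show "(f u, f v) \<in> parcs D" using arc[OF uv] E by force
  qed
  ultimately show "?bij \<and> ?adj" ..
next
  interpret D: pair_wf_digraph D by fact
  assume *: "?bij \<and> ?adj"
  let ?h = "\<lparr>iso_verts = f, iso_arcs = map_prod f f, iso_head = snd, iso_tail = fst\<rparr>"
  have inj: "inj_on f (pverts D)" and V: "f ` pverts D = pverts D"
    using * by (auto simp: bij_betw_def)
  have "map_prod f f ` parcs D = parcs D"
  proof (intro subset_antisym subrelI)
    fix x y assume "(x, y) \<in> map_prod f f ` parcs D"
    then show "(x, y) \<in> parcs D" using * D.wellformed' by auto
  next
    fix x y assume xy: "(x, y) \<in> parcs D"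
    then have "x \<in> f ` pverts D" "y \<in> f ` pverts D" using D.wellformed' V by auto
    then obtain u v where "x = f u" "y = f v" "u \<in> pverts D" "v \<in> pverts D" by blast
    with xy * show "(x, y) \<in> map_prod f f ` parcs D"
      by (auto intro!: image_eqI[of _ _ "(u, v)"])
  qed
  moreover have "inj_on (map_prod f f) (parcs D)"
    by (rule inj_on_subset[OF map_prod_inj_on[OF inj inj]]) (auto dest: D.wellformed')
  moreover have "wf_digraph (with_proj D)" by (rule D.wf_digraph_axioms)
  ultimately show "digraph_automorphism D f"
    unfolding digraph_automorphism_def
    by (intro exI[of _ ?h])
       (auto simp: pre_digraph.digraph_isomorphism_def app_iso_def with_proj_def inj V)
qed

lemma reachability_rel_subset:
  assumes "(e, e') \<in> reachability_rel D"
  shows "e \<in> parcs D" "e' \<in> parcs D"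
proof -
  obtain b p where p: "alternating_walk D b p" "length p \<ge> 2"
    "walk_arc b p 0 = e" "walk_arc b p (length p - 2) = e'"
    using assms by (auto simp: reachability_rel_def)
  have *: "walk_arc b p i \<in> parcs D" if "i + 1 < length p" for i
  proof (cases "even i = b")
    case True
    then show ?thesis using p(1) that by (auto simp: alternating_walk_def walk_arc_def)
  next
    case False
    then have "even (i + 1) = b" by auto
    then have "(p ! (i + 1), p ! (i + 1 - 1)) \<in> parcs D"
      using p(1) that unfolding alternating_walk_def by (metis le_add2)
    then show ?thesis using False by (auto simp: walk_arc_def)
  qed
  show "e \<in> parcs D" "e' \<in> parcs D"
    using *[of 0] *[of "length p - 2"] p(2-4) by auto
qed

lemma reachability_rel_automorphism:
  assumes wf: "pair_wf_digraph D" and f: "digraph_automorphism D f"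
    and e: "(e, e') \<in> reachability_rel D"
  shows "(map_prod f f e, map_prod f f e') \<in> reachability_rel D"
proof -
  obtain b p where p: "alternating_walk D b p" "length p \<ge> 2"
    "walk_arc b p 0 = e" "walk_arc b p (length p - 2) = e'"
    using e by (auto simp: reachability_rel_def)
  have V: "f ` pverts D = pverts D"
    and E: "\<And>u v. (u, v) \<in> parcs D \<Longrightarrow> (f u, f v) \<in> parcs D"
    using f pair_wf_digraph.wellformed'[OF wf]
    by (auto simp: digraph_automorphism_iff[OF wf] bij_betw_def)
  have "set (map f p) \<subseteq> pverts D"
    using p(1) V by (auto simp: alternating_walk_def)
  then have "alternating_walk D b (map f p)"
    using p(1) E by (auto simp: alternating_walk_def)
  moreover have "walk_arc b (map f p) i = map_prod f f (walk_arc b p i)" if "i + 1 < length p" for i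
    using that by (auto simp: walk_arc_def)
  ultimately show ?thesis using p(2-4)
    by (auto simp: reachability_rel_def intro!: exI[of _ b] exI[of _ "map f p"])
qed

lemma reachability_digraph_iso:
  assumes wf: "pair_wf_digraph D" and tr: "s_arc_transitive D 1" and e: "e \<in> parcs D"
  shows "digraph_iso (with_proj (reachability_digraph D)) (with_proj (arc_class_digraph D e))"
proof -
  interpret D: pair_wf_digraph D by fact
  define d where "d = (SOME e. e \<in> parcs D)"
  have d: "d \<in> parcs D" unfolding d_def using e by (rule someI)
  obtain u v x y where uv: "d = (u, v)" "e = (x, y)" by fastforce
  have s_arcs: "s_arc D 1 [u, v]" "s_arc D 1 [x, y]"
    using d e uv D.wellformed' by (auto simp: s_arc_def)
  have tr': "\<forall>p q. s_arc D 1 p \<longrightarrow> s_arc D 1 q \<longrightarrow>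
      (\<exists>f. digraph_automorphism D f \<and> map f p = q)"
    using tr unfolding s_arc_transitive_def by (elim conjE)
  have "\<exists>f. digraph_automorphism D f \<and> map f [u, v] = [x, y]"
    by (rule tr'[THEN spec, THEN spec, THEN mp, THEN mp, OF s_arcs])
  then obtain f where f: "digraph_automorphism D f" "map f [u, v] = [x, y]"
    by (elim exE conjE)
  have fd: "map_prod f f d = e" using f(2) uv by simp
  define g where "g = the_inv_into (pverts D) f"
  have bij: "bij_betw f (pverts D) (pverts D)"
    and adj: "\<And>a b. a \<in> pverts D \<Longrightarrow> b \<in> pverts D \<Longrightarrow> (f a, f b) \<in> parcs D \<longleftrightarrow> (a, b) \<in> parcs D"
    using f(1) by (auto simp: digraph_automorphism_iff[OF wf])
  have gf: "\<And>a. a \<in> pverts D \<Longrightarrow> g (f a) = a" and fg: "\<And>a. a \<in> pverts D \<Longrightarrow> f (g a) = a"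
    using bij unfolding g_def
    by (auto simp: bij_betw_def intro: the_inv_into_f_f f_the_inv_into_f)
  have bijg: "bij_betw g (pverts D) (pverts D)"
    unfolding g_def using bij by (rule bij_betw_the_inv_into)
  have "(g a, g b) \<in> parcs D \<longleftrightarrow> (a, b) \<in> parcs D" if "a \<in> pverts D" "b \<in> pverts D" for a b
    using adj[of "g a" "g b"] that bijg fg by (auto simp: bij_betw_def)
  with bijg have g: "digraph_automorphism D g"
    by (auto simp: digraph_automorphism_iff[OF wf])
  have gd: "map_prod g g e = d" using fd d gf uv D.wellformed' by auto
  define C C' where "C = reachability_rel D `` {d}" and "C' = reachability_rel D `` {e}"
  have CE: "C \<subseteq> parcs D" "C' \<subseteq> parcs D"
    unfolding C_def C'_def using reachability_rel_subset by blast+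
  have im: "map_prod f f ` C = C'"
  proof (intro subset_antisym subrelI)
    fix x y assume "(x, y) \<in> map_prod f f ` C"
    then obtain c where c: "c \<in> C" "(x, y) = map_prod f f c" by (rule imageE) (rule that)
    have "(d, c) \<in> reachability_rel D" using c(1) unfolding C_def by (rule ImageE) simp
    from reachability_rel_automorphism[OF wf f(1) this]
    show "(x, y) \<in> C'" unfolding fd c(2) C'_def by (rule ImageI) simp
  next
    fix a b assume ab: "(a, b) \<in> C'"
    have "(e, (a, b)) \<in> reachability_rel D" using ab unfolding C'_def by (rule ImageE) simp
    from reachability_rel_automorphism[OF wf g this]
    have "map_prod g g (a, b) \<in> C" unfolding gd C_def by (rule ImageI) simp
    moreover have "(a, b) \<in> parcs D" using ab CE(2) by (rule rev_subsetD)
    then have "a \<in> pverts D" "b \<in> pverts D" by (rule D.wellformed')+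
    then have "(a, b) = map_prod f f (map_prod g g (a, b))" by (simp add: fg)
    ultimately show "(a, b) \<in> map_prod f f ` C" by (rule rev_image_eqI)
  qed
  let ?h = "\<lparr>iso_verts = f, iso_arcs = map_prod f f, iso_head = snd, iso_tail = fst\<rparr>"
  have inj: "inj_on f (pverts D)" using bij by (simp add: bij_betw_def)
  have sub: "fst ` C \<union> snd ` C \<subseteq> pverts D"
    using CE D.arc_fst_in_verts D.arc_snd_in_verts by blast
  have injV: "inj_on f (fst ` C \<union> snd ` C)" using inj sub by (rule inj_on_subset)
  have injE: "inj_on (map_prod f f) C"
    by (rule inj_on_subset[OF map_prod_inj_on[OF inj inj]]) (use CE in \<open>auto dest: D.wellformed'\<close>)
  have vim: "f ` (fst ` C \<union> snd ` C) = fst ` C' \<union> snd ` C'"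
    unfolding im[symmetric] by (auto simp: image_Un image_image)
  have R: "reachability_digraph D = \<lparr>pverts = fst ` C \<union> snd ` C, parcs = C\<rparr>"
    and R': "arc_class_digraph D e = \<lparr>pverts = fst ` C' \<union> snd ` C', parcs = C'\<rparr>"
    by (simp_all add: reachability_digraph_def arc_class_digraph_def d_def[symmetric]
        C_def C'_def Let_def)
  have "wf_digraph (with_proj (reachability_digraph D))"
    unfolding R by unfold_locales auto
  then show ?thesis
    unfolding digraph_iso_def R R'
    by (intro exI[of _ ?h])
       (use injV injE vim im in
         \<open>simp add: pre_digraph.digraph_isomorphism_def app_iso_def with_proj_def\<close>)
qed

end

theory Submission
  imports Defs
begin

text \<open>
  For every integer \<open>k\<close>, the coordinates \<open>a\<^sub>j\<close> of the vertices \<open>(i, a)\<close> of \<open>D(T)\<close> with \<open>i - j = k\<close>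
  form the \<^emph>\<open>diagonal\<close> \<open>k\<close>.  An arc \<open>(i, a) \<rightarrow> (i + 1, b)\<close> relates \<open>a\<^sub>j\<close> to \<open>b\<^sub>j\<^sub>+\<^sub>1\<close>, and
  \<open>i - j = (i + 1) - (j + 1)\<close>, so arcs never relate different diagonals, and along a
  bi-infinite directed path \<open>(i, P i)\<close> of \<open>D(T)\<close>, here called a line, diagonal \<open>k\<close> traces the
  \<open>(t - 1)\<close>-arc \<open>P (k + 1) 1, \<dots>, P (k + t) t\<close> of \<open>T\<close>.  Hence a line is the same thing as an arbitrary
  family of \<open>(t - 1)\<close>-arcs of \<open>T\<close> indexed by the integers.  The degree conditions let every finite
  directed path of \<open>D(T)\<close> be prolonged to a line (\<open>s_arc_extends_to_line\<close>).

  \<^emph>\<open>Connectedness.\<close>  Given two lines, take the diagonals below \<open>i\<close> from the first one and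
  the others from the second one.  The resulting line agrees with the first at time \<open>i\<close> and with the
  second from time \<open>i + t\<close> on (\<open>line_splice\<close>).  So a vertex on the first line is joined to the
  far end of the second line.

  \<^emph>\<open>High arc-transitivity.\<close>  Automorphisms of \<open>T\<close> preserve the levels, and one may apply a different
  one on each diagonal to obtain an automorphism of \<open>D(T)\<close>
  (\<open>diagonalwise_automorphism\<close>).  As \<open>T\<close> is \<open>(t - 1)\<close>-arc-transitive, the diagonals of one
  line can be moved to those of any other.  So the automorphism group is transitive on lines
  with a marked starting time, hence on \<open>s\<close>-arcs for every \<open>s\<close>.

  \<^emph>\<open>Reachability.\<close>  Arcs with a common tail or head have tails of the same time, so a reachability
  class stays between two consecutive times.  Between two such times \<open>D(T)\<close> is a product of the
  bipartite digraphs \<open>T\<^sub>1, \<dots>, T\<^sub>t\<^sub>-\<^sub>1\<close> (together with one free coordinate at either end).  Two steps of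
  an alternating walk can change a single coordinate while all the others go back and
  forth along one arc, so the coordinates of a tail can be adjusted one after the other, using
  that each \<open>T\<^sub>i\<close> is connected (\<open>common_out_neighbour_rtrancl\<close>).
\<close>

section \<open>Reachability classes\<close>

text \<open>
  Consecutive arcs of an alternating walk share their tail or their head.  The reachability relation
  is handled through this relation, as its reflexive transitive closure.
\<close>

definition arc_sharing :: "'a pair_pre_digraph \<Rightarrow> ('a \<times> 'a) rel" where
  "arc_sharing D = {(e, e'). e \<in> parcs D \<and> e' \<in> parcs D \<and> (fst e = fst e' \<or> snd e = snd e')}"

lemma alternating_walk_snoc:
  assumes "alternating_walk D b p" and "pair_wf_digraph D"
    and "walk_arc b (p @ [w]) (length p - 1) \<in> parcs D"
  shows "alternating_walk D b (p @ [w])"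
proof -
  interpret pair_wf_digraph D by fact
  have ne: "p \<noteq> []" and sub: "set p \<subseteq> pverts D" using assms(1) by (auto simp: alternating_walk_def)
  let ?n = "length p"
  have last: "(p @ [w]) ! (?n - 1) = p ! (?n - 1)" "(p @ [w]) ! ?n = w"
    using ne by (auto simp: nth_append)
  have arc: "if even (?n - 1) = b then (p ! (?n - 1), w) \<in> parcs D else (w, p ! (?n - 1)) \<in> parcs D"
    using assms(3) last ne by (auto simp: walk_arc_def split: if_splits)
  then have w: "w \<in> pverts D" using wellformed' by (auto split: if_splits)
  have "(i + 1 < length (p @ [w]) \<longrightarrow> ((p @ [w]) ! i, (p @ [w]) ! (i + 1)) \<in> parcs D)
      \<and> (i \<ge> 1 \<longrightarrow> ((p @ [w]) ! i, (p @ [w]) ! (i - 1)) \<in> parcs D)"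
    if i: "i < length (p @ [w])" "even i = b" for i
  proof (cases "i = ?n")
    case True
    then have "even (?n - 1) \<noteq> b" using i(2) ne by (cases ?n) auto
    then show ?thesis using arc True last by auto
  next
    case False
    then have "i < ?n" using i by auto
    then have old: "i + 1 < ?n \<longrightarrow> (p ! i, p ! (i + 1)) \<in> parcs D"
      "i \<ge> 1 \<longrightarrow> (p ! i, p ! (i - 1)) \<in> parcs D"
      using assms(1) i(2) unfolding alternating_walk_def by blast+
    have "(p ! i, w) \<in> parcs D" if "i + 1 = ?n"
    proof -
      from that have "i = ?n - 1" by simp
      then show ?thesis using arc i(2) by simp
    qed
    then show ?thesis using old \<open>i < ?n\<close>
      by (cases "i + 1 = ?n") (auto simp: nth_append)
  qed
  then show ?thesis using ne sub w unfolding alternating_walk_def by auto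
qed

lemma walk_arc_in_parcs:
  assumes "alternating_walk D b p" "i + 1 < length p"
  shows "walk_arc b p i \<in> parcs D"
proof (cases "even i = b")
  case True
  then show ?thesis using assms by (auto simp: alternating_walk_def walk_arc_def)
next
  case False
  then have "even (i + 1) = b" by auto
  then have "(p ! (i + 1), p ! (i + 1 - 1)) \<in> parcs D"
    using assms unfolding alternating_walk_def by (metis le_add2)
  then show ?thesis using False by (auto simp: walk_arc_def)
qed

lemma walk_arc_append: "i + 1 < length p \<Longrightarrow> walk_arc b (p @ q) i = walk_arc b p i"
  by (auto simp: walk_arc_def nth_append)

lemma reachability_rel_snoc:
  assumes "alternating_walk D b p" "length p \<ge> 2" "pair_wf_digraph D"
    and "walk_arc b (p @ [w]) (length p - 1) \<in> parcs D"
  shows "(walk_arc b p 0, walk_arc b (p @ [w]) (length p - 1)) \<in> reachability_rel D"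
proof -
  have "alternating_walk D b (p @ [w])" by (rule alternating_walk_snoc[OF assms(1,3,4)])
  moreover have "walk_arc b (p @ [w]) 0 = walk_arc b p 0" using assms(2) by (simp add: walk_arc_append)
  moreover have "length (p @ [w]) - 2 = length p - 1" "2 \<le> length (p @ [w])" using assms(2) by auto
  ultimately show ?thesis
    unfolding reachability_rel_def mem_Collect_eq case_prod_conv by metis
qed

text \<open>
  If a walk has just traversed the arc \<open>e\<close>, it can go on to \<open>e'\<close> at once if it stands at the
  common end of the two arcs; otherwise it first traverses \<open>e\<close> back.
\<close>

lemma reachability_rel_step:
  assumes wf: "pair_wf_digraph D" and r: "(d, e) \<in> reachability_rel D" and s: "(e, e') \<in> arc_sharing D"
  shows "(d, e') \<in> reachability_rel D"
proof -
  obtain b p where p: "alternating_walk D b p" "length p \<ge> 2"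
    "walk_arc b p 0 = d" "walk_arc b p (length p - 2) = e"
    using r by (auto simp: reachability_rel_def)
  obtain u v where e: "e = (u, v)" by fastforce
  obtain x y where e': "e' = (x, y)" by fastforce
  have arcs: "(u, v) \<in> parcs D" "(x, y) \<in> parcs D" "u = x \<or> v = y"
    using s e e' by (auto simp: arc_sharing_def)
  obtain n where n: "length p = Suc (Suc n)" using p(2) by (metis add_2_eq_Suc le_Suc_ex)
  have last: "walk_arc b p (length p - 2) =
      (if even (length p) = b then (p ! (length p - 2), p ! (length p - 1))
       else (p ! (length p - 1), p ! (length p - 2)))"
    by (simp add: walk_arc_def n)
  have snoc: "walk_arc b (q @ [w]) (length q - 1) =
      (if even (length q) = b then (w, q ! (length q - 1)) else (q ! (length q - 1), w))"
    if "q \<noteq> []" for q w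
    using that by (cases "length q") (auto simp: walk_arc_def nth_append)
  have direct: "(walk_arc b q 0, (x, y)) \<in> reachability_rel D"
    if q: "alternating_walk D b q" "length q \<ge> 2"
      and l: "q ! (length q - 1) = (if even (length q) = b then y else x)" for q
  proof -
    let ?w = "if even (length q) = b then x else y"
    have "q \<noteq> []" using q(2) by auto
    from snoc[OF this, of ?w] have "walk_arc b (q @ [?w]) (length q - 1) = (x, y)"
      using l by (auto split: if_splits)
    then show ?thesis using reachability_rel_snoc[OF q wf, of ?w] arcs by simp
  qed
  have pne: "p \<noteq> []" using p(2) by auto
  show ?thesis
  proof (cases "p ! (length p - 1) = (if even (length p) = b then y else x)")
    case True
    then show ?thesis using direct[OF p(1,2)] p(3) e' by simp
  next
    case False
    let ?w = "p ! (length p - 2)"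
    have turn: "walk_arc b (p @ [?w]) (length p - 1) = (u, v)"
      unfolding snoc[OF pne] using last p(4) e by (cases "even (length p) = b") simp_all
    have walk: "alternating_walk D b (p @ [?w])"
      using alternating_walk_snoc[OF p(1) wf] turn arcs by simp
    have "(p @ [?w]) ! (length (p @ [?w]) - 1) = (if even (length (p @ [?w])) = b then y else x)"
    proof (cases "even (length p) = b")
      case True
      then have "p ! (length p - 2) = u" "p ! (length p - 1) = v" using last p(4) e by simp_all
      then show ?thesis using True False arcs(3) by simp
    next
      case odd: False
      then have "p ! (length p - 2) = v" "p ! (length p - 1) = u" using last p(4) e by simp_all
      then show ?thesis using odd False arcs(3) by simp
    qed
    from direct[OF walk _ this] show ?thesis using p e' by (simp add: walk_arc_append)
  qed
qed

lemma reachability_rel_refl: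
  assumes wf: "pair_wf_digraph D" and e: "e \<in> parcs D"
  shows "(e, e) \<in> reachability_rel D"
proof -
  have "alternating_walk D True [fst e, snd e]"
    using e pair_wf_digraph.wellformed'[OF wf, of "fst e" "snd e"]
    by (auto simp: alternating_walk_def less_Suc_eq)
  moreover have "walk_arc True [fst e, snd e] 0 = e" by (simp add: walk_arc_def)
  ultimately show ?thesis unfolding reachability_rel_def mem_Collect_eq case_prod_conv
    by (intro exI[of _ True] exI[of _ "[fst e, snd e]"]) simp
qed

lemma reachability_rel_iff_rtrancl:
  assumes wf: "pair_wf_digraph D" and e: "e \<in> parcs D"
  shows "(e, e') \<in> reachability_rel D \<longleftrightarrow> (e, e') \<in> (arc_sharing D)\<^sup>*"
proof
  assume "(e, e') \<in> reachability_rel D"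
  then obtain b p where p: "alternating_walk D b p" "length p \<ge> 2"
    "walk_arc b p 0 = e" "walk_arc b p (length p - 2) = e'"
    by (auto simp: reachability_rel_def)
  have "i + 1 < length p \<Longrightarrow> (walk_arc b p 0, walk_arc b p i) \<in> (arc_sharing D)\<^sup>*" for i
  proof (induction i)
    case (Suc i)
    have "walk_arc b p i \<in> parcs D" "walk_arc b p (Suc i) \<in> parcs D"
      using Suc.prems walk_arc_in_parcs[OF p(1)] by simp_all
    then have "(walk_arc b p i, walk_arc b p (Suc i)) \<in> arc_sharing D"
      by (cases "even i = b") (simp_all add: arc_sharing_def walk_arc_def)
    with Suc show ?case by (auto intro: rtrancl_into_rtrancl)
  qed simp
  from this[of "length p - 2"] show "(e, e') \<in> (arc_sharing D)\<^sup>*" using p by simp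
next
  assume "(e, e') \<in> (arc_sharing D)\<^sup>*"
  then show "(e, e') \<in> reachability_rel D"
    by induction (rule reachability_rel_refl[OF wf e], rule reachability_rel_step[OF wf])
qed

section \<open>Bi-infinite prolongations of finite paths\<close>

lemma finite_path_extends_bi_infinitely:
  fixes r :: "'b \<Rightarrow> 'b \<Rightarrow> bool" and a :: "nat \<Rightarrow> 'b"
  assumes out: "\<And>x. x \<in> X \<Longrightarrow> \<exists>y\<in>X. r x y" and inc: "\<And>x. x \<in> X \<Longrightarrow> \<exists>y\<in>X. r y x"
    and a: "\<And>m. m \<le> s \<Longrightarrow> a m \<in> X" "\<And>m. m < s \<Longrightarrow> r (a m) (a (Suc m))"
  obtains P :: "int \<Rightarrow> 'b" where "\<And>n. P n \<in> X" "\<And>n. r (P n) (P (n + 1))"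
    "\<And>m. m \<le> s \<Longrightarrow> P (int m) = a m"
proof -
  obtain S where S: "\<And>x. x \<in> X \<Longrightarrow> S x \<in> X \<and> r x (S x)" using out by metis
  obtain R where R: "\<And>x. x \<in> X \<Longrightarrow> R x \<in> X \<and> r (R x) x" using inc by metis
  define F where "F m = (S ^^ (m - s)) (a (min m s))" for m
  define B where "B m = (R ^^ m) (a 0)" for m
  define P where "P n = (if n \<ge> 0 then F (nat n) else B (nat (- n)))" for n
  have SX: "x \<in> X \<Longrightarrow> (S ^^ m) x \<in> X" for m x by (induction m) (use S in auto)
  have RX: "x \<in> X \<Longrightarrow> (R ^^ m) x \<in> X" for m x by (induction m) (use R in auto)
  have F: "F m \<in> X" for m unfolding F_def using SX a(1) by simp
  have B: "B m \<in> X" for m unfolding B_def using RX a(1) by simp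
  have rF: "r (F m) (F (Suc m))" for m
  proof (cases "m < s")
    case True then show ?thesis unfolding F_def using a(2) by simp
  next
    case False
    then have "F (Suc m) = S (F m)" unfolding F_def by (simp add: Suc_diff_le)
    then show ?thesis using S F by simp
  qed
  have rB: "r (B (Suc m)) (B m)" for m using R[OF B[of m]] unfolding B_def by simp
  have zero: "F 0 = B 0" by (simp add: F_def B_def)
  show thesis
  proof (rule that)
    show "P n \<in> X" for n unfolding P_def using F B by simp
    show "r (P n) (P (n + 1))" for n
    proof (cases "n \<ge> 0")
      case True
      then show ?thesis using rF[of "nat n"] by (simp add: P_def nat_add_distrib)
    next
      case False
      then obtain k where k: "n = - int (Suc k)" by (metis int_cases not_le zero_le_imp_eq_int of_nat_0_le_iff)
      have "P n = B (Suc k)" "P (n + 1) = B k"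
        using k zero by (cases k; simp add: P_def nat_add_distrib)+
      then show ?thesis using rB by simp
    qed
    show "P (int m) = a m" if "m \<le> s" for m using that by (simp add: P_def F_def)
  qed
qed

section \<open>Layered digraphs and lines\<close>

locale layered_digraph =
  fixes t :: nat and T :: "'a pair_pre_digraph" and A :: "nat \<Rightarrow> 'a set"
  assumes t: "2 \<le> t"
    and verts: "pverts T = (\<Union>j\<in>{1..t}. A j)"
    and disj: "disjoint_family_on A {1..t}"
    and nonempty: "j \<in> {1..t} \<Longrightarrow> A j \<noteq> {}"
    and arc_levels: "(u, v) \<in> parcs T \<Longrightarrow> \<exists>j\<in>{1..<t}. u \<in> A j \<and> v \<in> A (Suc j)"
    and in_arc: "j \<in> {1..<t} \<Longrightarrow> v \<in> A (Suc j) \<Longrightarrow> \<exists>u. (u, v) \<in> parcs T"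
    and out_arc: "j \<in> {1..<t} \<Longrightarrow> u \<in> A j \<Longrightarrow> \<exists>v. (u, v) \<in> parcs T"
begin

abbreviation X :: "(nat \<Rightarrow> 'a) set" where "X \<equiv> Pi\<^sub>E {1..t} A"

abbreviation D :: "(int \<times> (nat \<Rightarrow> 'a)) pair_pre_digraph" where "D \<equiv> level_digraph t A T"

definition link :: "(nat \<Rightarrow> 'a) \<Rightarrow> (nat \<Rightarrow> 'a) \<Rightarrow> bool" where
  "link a b \<longleftrightarrow> a \<in> X \<and> b \<in> X \<and> (\<forall>j\<in>{1..<t}. (a j, b (Suc j)) \<in> parcs T)"

lemma parcs_D: "((i, a), (i', b)) \<in> parcs D \<longleftrightarrow> i' = i + 1 \<and> link a b"
  by (auto simp: level_digraph_def link_def)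

lemma parcs_D': "e \<in> parcs D \<longleftrightarrow> (\<exists>i a b. e = ((i, a), (i + 1, b)) \<and> link a b)"
  by (auto simp: level_digraph_def link_def)

lemma pverts_D: "pverts D = UNIV \<times> X"
  by (simp add: level_digraph_def)

lemma wf_D: "pair_wf_digraph D"
  using pair_loopfree_level_digraph by (rule pair_loopfree_digraph.axioms)

lemma X_D: "a \<in> X \<Longrightarrow> j \<in> {1..t} \<Longrightarrow> a j \<in> A j"
  by (rule PiE_mem)

lemma level_unique: "v \<in> A i \<Longrightarrow> v \<in> A j \<Longrightarrow> i \<in> {1..t} \<Longrightarrow> j \<in> {1..t} \<Longrightarrow> i = j"
  using disj unfolding disjoint_family_on_def by blast

lemma arc_tail_level: "(u, v) \<in> parcs T \<Longrightarrow> u \<in> A j \<Longrightarrow> j \<in> {1..t} \<Longrightarrow> j < t \<and> v \<in> A (Suc j)"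
  using arc_levels[of u v] level_unique[of u] by fastforce

lemma arc_head_level: "(u, v) \<in> parcs T \<Longrightarrow> v \<in> A (Suc j) \<Longrightarrow> j \<in> {1..<t} \<Longrightarrow> u \<in> A j"
  using arc_levels[of u v] level_unique[of v] by fastforce

lemma wf_T: "pair_wf_digraph T"
  by unfold_locales (use arc_levels verts in fastforce)+

text \<open>The first coordinate of the out-neighbour is arbitrary, so any element of \<open>A 1\<close> will do.\<close>

lemma link_out: assumes "a \<in> X" shows "\<exists>b\<in>X. link a b"
proof -
  have "\<exists>y. y \<in> A j \<and> (1 < j \<longrightarrow> (a (j - 1), y) \<in> parcs T)" if j: "j \<in> {1..t}" for j
  proof (cases "j = 1")
    case True then show ?thesis using nonempty[OF j] by auto
  next
    case False
    then have "j - 1 \<in> {1..<t}" "Suc (j - 1) = j" using j by auto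
    moreover from this have "a (j - 1) \<in> A (j - 1)" using X_D[OF assms, of "j - 1"] by simp
    ultimately show ?thesis using out_arc[of "j - 1"] arc_tail_level[of "a (j - 1)" _ "j - 1"] by fastforce
  qed
  then obtain y where y: "\<And>j. j \<in> {1..t} \<Longrightarrow> y j \<in> A j \<and> (1 < j \<longrightarrow> (a (j - 1), y j) \<in> parcs T)"
    by metis
  have "restrict y {1..t} \<in> X" using y by (simp add: restrict_PiE_iff)
  moreover have "(a j, restrict y {1..t} (Suc j)) \<in> parcs T" if "j \<in> {1..<t}" for j
    using y[of "Suc j"] that by simp
  ultimately show ?thesis using assms unfolding link_def by blast
qed

lemma link_in: assumes "b \<in> X" shows "\<exists>a\<in>X. link a b"
proof -
  have "\<exists>y. y \<in> A j \<and> (j < t \<longrightarrow> (y, b (Suc j)) \<in> parcs T)" if j: "j \<in> {1..t}" for j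
  proof (cases "j = t")
    case True then show ?thesis using nonempty[OF j] by auto
  next
    case False
    then have "b (Suc j) \<in> A (Suc j)" "j \<in> {1..<t}" using X_D[OF assms, of "Suc j"] j by auto
    then show ?thesis using in_arc[of j] arc_head_level[of _ "b (Suc j)" j] by fastforce
  qed
  then obtain y where y: "\<And>j. j \<in> {1..t} \<Longrightarrow> y j \<in> A j \<and> (j < t \<longrightarrow> (y j, b (Suc j)) \<in> parcs T)"
    by metis
  have "link (restrict y {1..t}) b" unfolding link_def using assms y by auto
  then show ?thesis unfolding link_def by blast
qed

definition line :: "(int \<Rightarrow> nat \<Rightarrow> 'a) \<Rightarrow> bool" where
  "line P \<longleftrightarrow> (\<forall>n. link (P n) (P (n + 1)))"

lemma line_X: "line P \<Longrightarrow> P n \<in> X"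
  by (auto simp: line_def link_def)

lemma line_arc: "line P \<Longrightarrow> j \<in> {1..<t} \<Longrightarrow> (P n j, P (n + 1) (Suc j)) \<in> parcs T"
  by (simp add: line_def link_def)

lemma s_arc_of_line: "line P \<Longrightarrow> s_arc D s (map (\<lambda>m. (i + int m, P (i + int m))) [0..<Suc s])"
  using line_X[of P]
  by (auto simp: s_arc_def pverts_D parcs_D line_def nth_append add.assoc simp del: upt_Suc)
     (metis add.assoc add.commute)

lemma s_arc_extends_to_line:
  assumes "s_arc D s p"
  obtains i P where "line P" "p = map (\<lambda>m. (i + int m, P (i + int m))) [0..<Suc s]"
proof -
  have len: "length p = Suc s" and sub: "set p \<subseteq> pverts D"
    and arcs: "\<And>m. m < s \<Longrightarrow> (p ! m, p ! Suc m) \<in> parcs D"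
    using assms by (auto simp: s_arc_def)
  define i where "i = fst (p ! 0)"
  have time: "m \<le> s \<Longrightarrow> fst (p ! m) = i + int m" for m
  proof (induction m)
    case (Suc m)
    then show ?case using arcs[of m] by (auto simp: parcs_D')
  qed (simp add: i_def)
  have vX: "snd (p ! m) \<in> X" if "m \<le> s" for m
  proof -
    have "p ! m \<in> pverts D" using that len sub nth_mem[of m p] by auto
    then show ?thesis by (auto simp: pverts_D)
  qed
  have vlink: "link (snd (p ! m)) (snd (p ! Suc m))" if "m < s" for m
    using arcs[OF that] parcs_D[of "fst (p ! m)" "snd (p ! m)" "fst (p ! Suc m)" "snd (p ! Suc m)"] by simp
  obtain Q where Q: "\<And>n. Q n \<in> X" "\<And>n. link (Q n) (Q (n + 1))" "\<And>m. m \<le> s \<Longrightarrow> Q (int m) = snd (p ! m)"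
    using finite_path_extends_bi_infinitely[of X link s "\<lambda>m. snd (p ! m)", OF link_out link_in vX vlink]
    by blast
  define P where "P n = Q (n - i)" for n
  have "line P" using Q(2) by (simp add: line_def P_def diff_add_eq[symmetric])
  moreover have "p = map (\<lambda>m. (i + int m, P (i + int m))) [0..<Suc s]"
    by (rule nth_equalityI) (use len time Q(3) in \<open>auto simp: P_def prod_eq_iff less_Suc_eq_le simp del: upt_Suc\<close>)
  ultimately show ?thesis using that by blast
qed

lemma vertex_on_line: assumes "a \<in> X" obtains P where "line P" "P i = a"
proof -
  have "s_arc D 0 [(i, a)]" using assms by (simp add: s_arc_def pverts_D)
  then obtain i' P where "line P" "[(i, a)] = map (\<lambda>m. (i' + int m, P (i' + int m))) [0..<Suc 0]"
    by (rule s_arc_extends_to_line)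
  then show ?thesis using that by auto
qed

section \<open>Connectedness\<close>

text \<open>A line may be composed freely of diagonals of other lines, as no arc relates two diagonals.\<close>

lemma line_splice:
  assumes "line P" "line Q"
  obtains R where "line R" "R i = P i" "\<And>n. n \<ge> i + int t \<Longrightarrow> R n = Q n"
proof -
  \<comment> \<open>As \<open>1 \<le> j \<le> t\<close>, every diagonal \<open>n - j\<close> is below \<open>i\<close> for \<open>n = i\<close>, and none is for \<open>n \<ge> i + t\<close>.\<close>
  define R where "R n = (\<lambda>j\<in>{1..t}. if n - int j < i then P n j else Q n j)" for n
  have restr: "P n = (\<lambda>j\<in>{1..t}. P n j)" "Q n = (\<lambda>j\<in>{1..t}. Q n j)" for n
    using line_X[OF assms(1)] line_X[OF assms(2)] by (metis PiE_restrict)+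
  show thesis
  proof (rule that)
    have "R n \<in> X" for n
      unfolding R_def restrict_PiE_iff
      using X_D[OF line_X[OF assms(1)]] X_D[OF line_X[OF assms(2)]] by simp
    moreover have "(R n j, R (n + 1) (Suc j)) \<in> parcs T" if "j \<in> {1..<t}" for n j
      using line_arc[OF assms(1) that] line_arc[OF assms(2) that] that by (auto simp: R_def)
    ultimately show "line R" by (auto simp: line_def link_def)
    show "R i = P i" by (subst restr(1)) (auto simp: R_def restrict_def)
    show "R n = Q n" if "n \<ge> i + int t" for n
      by (subst restr(2)) (use that in \<open>auto simp: R_def restrict_def\<close>)
  qed
qed

lemma line_reachable:
  assumes "line P"
  shows "(i, P i) \<rightarrow>\<^sup>*\<^bsub>with_proj D\<^esub> (i + int m, P (i + int m))"
proof (induction m)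
  case 0
  then show ?case using line_X[OF assms] by (simp add: pverts_D wf_digraph.reachable_refl[OF wf_D[folded wf_digraph_wp_iff]])
next
  case (Suc m)
  have "(i + int m, P (i + int m)) \<rightarrow>\<^bsub>with_proj D\<^esub> (i + int (Suc m), P (i + int (Suc m)))"
    using assms[unfolded line_def, THEN spec, of "i + int m"] by (simp add: parcs_D ac_simps)
  with Suc show ?case by (rule wf_digraph.reachable_adj_trans[OF wf_D[folded wf_digraph_wp_iff]])
qed

theorem connected_D: "Digraph_Component.connected (with_proj D)"
proof -
  interpret D: pair_wf_digraph D by (rule wf_D)
  interpret S: pair_wf_digraph "mk_symmetric (with_proj D)" by (rule D.wellformed_mk_symmetric)
  have "x \<rightarrow>\<^sup>*\<^bsub>with_proj (mk_symmetric (with_proj D))\<^esub> y" if xy: "x \<in> pverts D" "y \<in> pverts D" for x y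
  proof -
    obtain i a where x: "x = (i, a)" "a \<in> X" using xy(1) by (auto simp: pverts_D)
    obtain k c where y: "y = (k, c)" "c \<in> X" using xy(2) by (auto simp: pverts_D)
    obtain P where P: "line P" "P i = a" using x(2) by (rule vertex_on_line)
    obtain Q where Q: "line Q" "Q k = c" using y(2) by (rule vertex_on_line)
    obtain R where R: "line R" "R i = P i" "\<And>n. n \<ge> i + int t \<Longrightarrow> R n = Q n"
      using line_splice[OF P(1) Q(1)] by blast
    obtain N where N: "N \<ge> k" "N \<ge> i" "N \<ge> i + int t" by (rule that[of "max k (i + int t)"]) auto
    have "x \<rightarrow>\<^sup>*\<^bsub>with_proj D\<^esub> (N, Q N)"
      using line_reachable[OF R(1), of i "nat (N - i)"] R(2,3) P(2) x(1) N by simp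
    moreover have "y \<rightarrow>\<^sup>*\<^bsub>with_proj D\<^esub> (N, Q N)"
      using line_reachable[OF Q(1), of k "nat (N - k)"] Q(2) y(1) N by simp
    ultimately show ?thesis
      by (rule S.reachable_trans[OF D.reachable_mk_symmetricI
            symmetric_reachable[OF symmetric_mk_symmetric D.reachable_mk_symmetricI]])
  qed
  moreover have "pverts D \<noteq> {}" using nonempty by (auto simp: pverts_D PiE_eq_empty_iff)
  ultimately show ?thesis by (intro D.connectedI) auto
qed

section \<open>Arc-transitivity\<close>

text \<open>\<open>A 1\<close> consists of the sources of \<open>T\<close>, and \<open>A (Suc j)\<close> of the heads of arcs from \<open>A j\<close>.\<close>

lemma automorphism_preserves_levels:
  assumes f: "digraph_automorphism T f" and j: "j \<in> {1..t}"
  shows "f ` A j = A j"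
proof -
  have im: "f ` pverts T = pverts T"
    and adj: "\<And>u v. u \<in> pverts T \<Longrightarrow> v \<in> pverts T \<Longrightarrow> (f u, f v) \<in> parcs T \<longleftrightarrow> (u, v) \<in> parcs T"
    using f by (auto simp: digraph_automorphism_iff[OF wf_T] bij_betw_def)
  interpret T: pair_wf_digraph T by (rule wf_T)
  have fwd: "Suc j \<in> {1..t} \<Longrightarrow> v \<in> A (Suc j) \<Longrightarrow> f v \<in> A (Suc j)" for j v
  proof (induction j arbitrary: v)
    case 0
    then have v: "v \<in> pverts T" using verts by auto
    then have "f v \<in> pverts T" using im by auto
    then obtain k where k: "k \<in> {1..t}" "f v \<in> A k" using verts by auto
    have "k = 1"
    proof (rule ccontr)
      assume "k \<noteq> 1"
      then obtain k' where "k = Suc k'" "k' \<in> {1..<t}" using k by (cases k) auto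
      then obtain w where w: "(w, f v) \<in> parcs T" using in_arc k by auto
      then obtain u where "u \<in> pverts T" "w = f u" using im T.wellformed' by (metis imageE)
      then have "(u, v) \<in> parcs T" using adj v w by auto
      then obtain l where "l \<in> {1..<t}" "v \<in> A (Suc l)" using arc_levels by blast
      then show False using level_unique[of v "Suc 0" "Suc l"] 0 by auto
    qed
    then show ?case using k by simp
  next
    case (Suc j)
    then obtain u where uv: "(u, v) \<in> parcs T" using in_arc[of "Suc j" v] by auto
    then have "u \<in> A (Suc j)" using arc_head_level Suc.prems by auto
    then have "f u \<in> A (Suc j)" using Suc by auto
    moreover have "(f u, f v) \<in> parcs T" using uv adj T.wellformed' by blast
    ultimately show ?case using arc_tail_level Suc.prems by auto
  qed
  have fwd: "v \<in> A j \<Longrightarrow> f v \<in> A j" if "j \<in> {1..t}" for j v using fwd[of "j - 1" v] that by auto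
  have "w \<in> f ` A j" if "w \<in> A j" for w
  proof -
    from that obtain v where v: "v \<in> pverts T" "w = f v" using im j verts by (metis UN_I imageE)
    then obtain k where k: "k \<in> {1..t}" "v \<in> A k" using verts by auto
    then have "k = j" using fwd[OF k] level_unique[of w] that v(2) j by auto
    then show ?thesis using v k by auto
  qed
  then show ?thesis using fwd[OF j] by blast
qed

text \<open>
  For an arc from \<open>(i, a)\<close> to \<open>(i + 1, b)\<close>, both \<open>a j\<close> and \<open>b (Suc j)\<close> lie on the diagonal \<open>i - j\<close>
  and are moved by the same automorphism of \<open>T\<close>.  The family \<open>f\<close> may therefore be arbitrary.
\<close>

lemma diagonalwise_automorphism:
  assumes f: "\<And>k. digraph_automorphism T (f k)"
  shows "digraph_automorphism D (\<lambda>(i, a). (i + c, \<lambda>j\<in>{1..t}. f (i - int j) (a j)))"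
    (is "digraph_automorphism D ?F")
proof -
  have adj: "\<And>u v. u \<in> pverts T \<Longrightarrow> v \<in> pverts T \<Longrightarrow> (f k u, f k v) \<in> parcs T \<longleftrightarrow> (u, v) \<in> parcs T"
    and inj: "inj_on (f k) (pverts T)" for k
    using f[of k] by (auto simp: digraph_automorphism_iff[OF wf_T] bij_betw_def)
  note lev = automorphism_preserves_levels[OF f]
  have AT: "j \<in> {1..t} \<Longrightarrow> A j \<subseteq> pverts T" for j using verts by auto
  have FX: "(\<lambda>j\<in>{1..t}. f (i - int j) (a j)) \<in> X" if "a \<in> X" for i a
    unfolding restrict_PiE_iff using X_D[OF that] lev by blast
  have "bij_betw ?F (pverts D) (pverts D)"
    unfolding bij_betw_def
  proof
    show "inj_on ?F (pverts D)"
    proof (rule inj_onI)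
      fix x y assume xy: "x \<in> pverts D" "y \<in> pverts D" "?F x = ?F y"
      obtain i a b where ab: "x = (i, a)" "y = (i, b)" "a \<in> X" "b \<in> X"
        using xy by (auto simp: pverts_D)
      have "a j = b j" if j: "j \<in> {1..t}" for j
      proof -
        have "f (i - int j) (a j) = f (i - int j) (b j)"
          using xy(3) ab(1,2) j by (auto dest: fun_cong[of _ _ j])
        moreover have "a j \<in> pverts T" "b j \<in> pverts T" using X_D[OF ab(3) j] X_D[OF ab(4) j] AT[OF j] by auto
        ultimately show ?thesis using inj by (auto dest: inj_onD)
      qed
      then show "x = y" using ab by (auto intro: PiE_ext)
    qed
    show "?F ` pverts D = pverts D"
    proof (intro subset_antisym subsetI)
      fix x assume "x \<in> ?F ` pverts D"
      then obtain i a where "x = (i + c, \<lambda>j\<in>{1..t}. f (i - int j) (a j))" "a \<in> X"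
        by (auto simp: pverts_D)
      then show "x \<in> pverts D" using FX[of a i] unfolding pverts_D by blast
    next
      fix x assume "x \<in> pverts D"
      then obtain i b where x: "x = (i, b)" "b \<in> X" by (auto simp: pverts_D)
      have "\<exists>u. u \<in> A j \<and> f (i - c - int j) u = b j" if j: "j \<in> {1..t}" for j
      proof -
        have "b j \<in> f (i - c - int j) ` A j" unfolding lev[OF j] using X_D[OF x(2) j] .
        then obtain u where "b j = f (i - c - int j) u" "u \<in> A j" by (rule imageE)
        then show ?thesis by (intro exI[of _ u]) simp
      qed
      then obtain a where a: "\<And>j. j \<in> {1..t} \<Longrightarrow> a j \<in> A j \<and> f (i - c - int j) (a j) = b j" by metis
      have eq: "?F (i - c, restrict a {1..t}) = x"
        using a x by (auto simp: restrict_def PiE_iff extensional_def)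
      have "(i - c, restrict a {1..t}) \<in> pverts D" using a by (auto simp: pverts_D)
      then show "x \<in> ?F ` pverts D"
        by (rule image_eqI[where f = ?F and x = "(i - c, restrict a {1..t})", OF eq[symmetric]])
    qed
  qed
  moreover have "(?F u, ?F v) \<in> parcs D \<longleftrightarrow> (u, v) \<in> parcs D" if uv: "u \<in> pverts D" "v \<in> pverts D" for u v
  proof -
    obtain i a where u: "u = (i, a)" "a \<in> X" using uv(1) by (auto simp: pverts_D)
    obtain k b where v: "v = (k, b)" "b \<in> X" using uv(2) by (auto simp: pverts_D)
    let ?a = "\<lambda>j\<in>{1..t}. f (i - int j) (a j)" and ?b = "\<lambda>j\<in>{1..t}. f (k - int j) (b j)"
    have "?a \<in> X" "?b \<in> X" using FX u(2) v(2) by blast+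
    moreover have "(?a j, ?b (Suc j)) \<in> parcs T \<longleftrightarrow> (a j, b (Suc j)) \<in> parcs T"
      if j: "j \<in> {1..<t}" and k: "k = i + 1" for j
    proof -
      have "a j \<in> pverts T" "b (Suc j) \<in> pverts T"
        using X_D[OF u(2), of j] X_D[OF v(2), of "Suc j"] AT[of j] AT[of "Suc j"] j by auto
      then show ?thesis using adj[of "a j" "b (Suc j)" "i - int j"] j k by simp
    qed
    moreover have "k + c = i + c + 1 \<longleftrightarrow> k = i + 1" by auto
    ultimately show ?thesis
      unfolding u v prod.case parcs_D link_def using u(2) v(2) by blast
  qed
  ultimately show ?thesis unfolding digraph_automorphism_iff[OF wf_D] by blast
qed

lemma line_diagonal_s_arc:
  assumes "line P"
  shows "s_arc T (t - 1) (map (\<lambda>j. P (k + int j) j) [1..<Suc t])"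
proof -
  have "P (k + int j) j \<in> pverts T" if "j \<in> {1..t}" for j
    using X_D[OF line_X[OF assms] that] that verts by blast
  moreover have "(P (k + int (Suc i)) (Suc i), P (k + int (Suc (Suc i))) (Suc (Suc i))) \<in> parcs T" if "i < t - 1" for i
    using line_arc[OF assms, of "Suc i" "k + int (Suc i)"] that by (auto simp: algebra_simps)
  ultimately show ?thesis using t by (auto simp: s_arc_def simp del: upt_Suc)
qed

lemma automorphism_moving_line:
  assumes tr: "s_arc_transitive T (t - 1)" and P: "line P" and Q: "line Q"
  shows "\<exists>F. digraph_automorphism D F \<and> (\<forall>n. F (n, P n) = (n + c, Q (n + c)))"
proof -
  have "\<exists>f. digraph_automorphism T f \<and>
      map f (map (\<lambda>j. P (k + int j) j) [1..<Suc t]) = map (\<lambda>j. Q (k + c + int j) j) [1..<Suc t]" for k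
    using tr line_diagonal_s_arc[OF P, of k] line_diagonal_s_arc[OF Q, of "k + c"]
    unfolding s_arc_transitive_def by blast
  then have "\<forall>k. \<exists>f. digraph_automorphism T f \<and>
      map f (map (\<lambda>j. P (k + int j) j) [1..<Suc t]) = map (\<lambda>j. Q (k + c + int j) j) [1..<Suc t]" ..
  from choice[OF this] obtain f where f: "\<And>k. digraph_automorphism T (f k)"
    and fm: "\<And>k. map (f k) (map (\<lambda>j. P (k + int j) j) [1..<Suc t]) = map (\<lambda>j. Q (k + c + int j) j) [1..<Suc t]"
    by blast
  have fPQ: "f (n - int j) (P n j) = Q (n + c) j" if "j \<in> {1..t}" for n j
  proof -
    have "f k (P (k + int j) j) = Q (k + c + int j) j" for k
      using fm[of k] that by (auto simp del: upt_Suc)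
    from this[of "n - int j"] show ?thesis by (simp add: algebra_simps)
  qed
  have "(\<lambda>j\<in>{1..t}. f (n - int j) (P n j)) = Q (n + c)" for n
    using line_X[OF Q, of "n + c"] fPQ by (auto simp: restrict_def PiE_iff extensional_def)
  then show ?thesis
    using diagonalwise_automorphism[of f c, OF f] by (intro exI conjI) auto
qed

theorem highly_arc_transitive_D:
  assumes tr: "s_arc_transitive T (t - 1)"
  shows "highly_arc_transitive D"
  unfolding highly_arc_transitive_def s_arc_transitive_def
proof (intro allI conjI impI ballI)
  fix s v
  show "\<not> isolated_vertex D v"
  proof
    assume iso: "isolated_vertex D v"
    then obtain i a where v: "v = (i, a)" "a \<in> X" by (auto simp: isolated_vertex_def pverts_D)
    then obtain b where "link a b" using link_out by blast
    then have "(v, (i + 1, b)) \<in> out_arcs (with_proj D) v" by (simp add: v parcs_D out_arcs_def)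
    then show False using iso unfolding isolated_vertex_def by blast
  qed
next
  fix s :: nat and e assume s: "1 \<le> s" and e: "e \<in> parcs D"
  obtain u v where uv: "e = (u, v)" by (cases e)
  have "s_arc D 1 [u, v]" using e uv pair_wf_digraph.wellformed'[OF wf_D, of u v] by (auto simp: s_arc_def)
  then obtain i P where P: "line P" "[u, v] = map (\<lambda>m. (i + int m, P (i + int m))) [0..<Suc 1]"
    by (rule s_arc_extends_to_line)
  let ?p = "map (\<lambda>m. (i + int m, P (i + int m))) [0..<Suc s]"
  have "e = (?p ! 0, ?p ! (0 + 1))" using P(2) uv s by (auto simp del: upt_Suc simp: upt_rec)
  then show "\<exists>p. s_arc D s p \<and> (\<exists>i<s. e = (p ! i, p ! (i + 1)))"
    using s_arc_of_line[OF P(1), of s i] s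
    by (intro exI[of _ ?p] conjI exI[of _ "0::nat"]) auto
next
  fix s p q assume p: "s_arc D s p" and q: "s_arc D s q"
  obtain i P where P: "line P" "p = map (\<lambda>m. (i + int m, P (i + int m))) [0..<Suc s]"
    using p by (rule s_arc_extends_to_line)
  obtain k Q where Q: "line Q" "q = map (\<lambda>m. (k + int m, Q (k + int m))) [0..<Suc s]"
    using q by (rule s_arc_extends_to_line)
  obtain F where F: "digraph_automorphism D F" "\<And>n. F (n, P n) = (n + (k - i), Q (n + (k - i)))"
    using automorphism_moving_line[OF tr P(1) Q(1), of "k - i"] by blast
  have "map F p = q" using F(2) P(2) Q(2) by (simp add: algebra_simps del: upt_Suc)
  with F(1) show "\<exists>f. digraph_automorphism D f \<and> map f p = q" by blast
qed

section \<open>The reachability digraph\<close>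

definition common_out_neighbour :: "'a rel" where
  "common_out_neighbour = {(x, y). \<exists>z. (x, z) \<in> parcs T \<and> (y, z) \<in> parcs T}"

text \<open>
  A walk in the underlying graph of \<open>T\<^sub>j\<close> alternates between the two levels, so every second vertex
  lies in \<open>A j\<close> and consecutive ones of these have a common out-neighbour.  For the induction, the
  statement also covers walks that end in \<open>A (Suc j)\<close>.
\<close>

lemma common_out_neighbour_rtrancl:
  assumes con: "Digraph_Component.connected (with_proj T \<restriction> (A j \<union> A (Suc j)))"
    and j: "j \<in> {1..<t}" and xy: "x \<in> A j" "y \<in> A j"
  shows "(x, y) \<in> common_out_neighbour\<^sup>*"
proof -
  let ?H = "with_proj T \<restriction> (A j \<union> A (Suc j))"
  let ?R = "common_out_neighbour\<^sup>*"
  have arc: "(u \<in> A j \<and> v \<in> A (Suc j) \<and> (u, v) \<in> parcs T) \<or> (v \<in> A j \<and> u \<in> A (Suc j) \<and> (v, u) \<in> parcs T)"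
    if "(u, v) \<in> parcs (mk_symmetric ?H)" for u v
  proof -
    have "u' \<in> A j \<and> v' \<in> A (Suc j)"
      if a: "(u', v') \<in> parcs T" "u' \<in> A j \<union> A (Suc j)" "v' \<in> A j \<union> A (Suc j)" for u' v'
    proof -
      obtain l where l: "l \<in> {1..<t}" "u' \<in> A l" "v' \<in> A (Suc l)" using arc_levels[OF a(1)] by blast
      have "l = j \<or> l = Suc j"
        using a(2) level_unique[OF l(2), of j] level_unique[OF l(2), of "Suc j"] l(1) j by auto
      moreover have "Suc l = j \<or> Suc l = Suc j"
        using a(3) level_unique[OF l(3), of j] level_unique[OF l(3), of "Suc j"] l(1) j by auto
      ultimately show ?thesis using l by auto
    qed
    then show ?thesis using that by (auto simp: mk_symmetric_def)
  qed
  have excl: "A j \<inter> A (Suc j) = {}" using level_unique[of _ j "Suc j"] j by auto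
  have "x \<rightarrow>\<^sup>*\<^bsub>with_proj (mk_symmetric ?H)\<^esub> y"
    using con xy by (auto simp: Digraph_Component.connected_def strongly_connected_def)
  then have "(x, y) \<in> rtrancl_on (A j \<union> A (Suc j)) (parcs (mk_symmetric ?H))"
    by (simp add: reachable_def)
  then have "(y \<in> A j \<longrightarrow> (x, y) \<in> ?R) \<and>
      (y \<in> A (Suc j) \<longrightarrow> (\<forall>w. (w, y) \<in> parcs T \<longrightarrow> (x, w) \<in> ?R))"
  proof (induction rule: rtrancl_on_induct)
    case base
    then show ?case using xy excl by auto
  next
    case (step y z)
    from arc[OF step.hyps(2)] show ?case
    proof
      assume yz: "y \<in> A j \<and> z \<in> A (Suc j) \<and> (y, z) \<in> parcs T"
      then have "(x, w) \<in> ?R" if "(w, z) \<in> parcs T" for w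
        using step.IH that by (auto simp: common_out_neighbour_def intro: rtrancl_into_rtrancl)
      then show ?thesis using yz excl by auto
    next
      assume "z \<in> A j \<and> y \<in> A (Suc j) \<and> (z, y) \<in> parcs T"
      then show ?thesis using step.IH excl by auto
    qed
  qed
  then show ?thesis using xy by blast
qed

definition common_link :: "(nat \<Rightarrow> 'a) rel" where
  "common_link = {(a, a'). \<exists>b. link a b \<and> link a' b}"

text \<open>
  Only the coordinate \<open>j\<close> changes, the others return along the arc that they took.
  The coordinate \<open>t\<close> is unconstrained, since it does not matter for the arcs leaving a vertex.
\<close>

lemma common_link_update:
  assumes a: "a \<in> X" and j: "j \<in> {1..t}" and y: "y \<in> A j"
    and c: "j < t \<Longrightarrow> (a j, y) \<in> common_out_neighbour"
  shows "(a, a(j := y)) \<in> common_link"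
proof -
  obtain b where b: "link a b" using link_out[OF a] by blast
  have ay: "a(j := y) \<in> X" using a j y by (auto simp: PiE_iff extensional_def)
  show ?thesis
  proof (cases "j < t")
    case False
    then have "link (a(j := y)) b" using b ay by (auto simp: link_def)
    then show ?thesis using b by (auto simp: common_link_def)
  next
    case True
    obtain z where z: "(a j, z) \<in> parcs T" "(y, z) \<in> parcs T"
      using c[OF True] by (auto simp: common_out_neighbour_def)
    then have "z \<in> A (Suc j)" using arc_tail_level y j by blast
    then have "b(Suc j := z) \<in> X" using b j True by (auto simp: link_def PiE_iff extensional_def)
    then have "link a (b(Suc j := z))" "link (a(j := y)) (b(Suc j := z))"
      using b ay z by (auto simp: link_def)
    then show ?thesis by (auto simp: common_link_def)
  qed
qed

lemma common_link_update_rtrancl: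
  assumes a: "a \<in> X" and j: "j \<in> {1..<t}" and y: "(a j, y) \<in> common_out_neighbour\<^sup>*"
  shows "(a, a(j := y)) \<in> common_link\<^sup>*"
proof -
  have aj: "a j \<in> A j" using a j by (auto simp: PiE_iff)
  from y have "y \<in> A j \<and> (a, a(j := y)) \<in> common_link\<^sup>*"
  proof induction
    case base
    show ?case using aj by simp
  next
    case (step y z)
    then have z: "z \<in> A j"
      using arc_tail_level[of y _ j] arc_head_level[of z _ j] j by (auto simp: common_out_neighbour_def)
    have "a(j := y) \<in> X" using a j step.IH by (auto simp: PiE_iff extensional_def)
    then have "(a(j := y), (a(j := y))(j := z)) \<in> common_link"
      by (rule common_link_update) (use j z step.hyps in auto)
    then have "(a(j := y), a(j := z)) \<in> common_link" by (simp only: fun_upd_upd)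
    with z show ?case using rtrancl_into_rtrancl[OF conjunct2[OF step.IH]] by blast
  qed
  then show ?thesis by simp
qed

lemma common_link_connected:
  assumes con: "\<And>j. j \<in> {1..<t} \<Longrightarrow> Digraph_Component.connected (with_proj T \<restriction> (A j \<union> A (Suc j)))"
    and a: "a \<in> X" and b: "b \<in> X"
  shows "(a, b) \<in> common_link\<^sup>*"
proof -
  define mix where "mix n = (\<lambda>j. if j \<in> {1..n} then b j else a j)" for n
  have "n \<le> t \<Longrightarrow> mix n \<in> X \<and> (a, mix n) \<in> common_link\<^sup>*" for n
  proof (induction n)
    case 0
    have "mix 0 = a" by (simp add: mix_def)
    then show ?case using a by simp
  next
    case (Suc n)
    let ?j = "Suc n"
    have mX: "mix n \<in> X" and IH: "(a, mix n) \<in> common_link\<^sup>*" using Suc by auto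
    have j: "?j \<in> {1..t}" using Suc.prems by auto
    have bj: "b ?j \<in> A ?j" "mix n ?j \<in> A ?j" using b mX j by (auto simp: PiE_iff)
    have upd: "mix ?j = (mix n)(?j := b ?j)" by (auto simp: mix_def fun_eq_iff)
    have "(mix n, mix ?j) \<in> common_link\<^sup>*"
    proof (cases "?j < t")
      case True
      then have j': "?j \<in> {1..<t}" by simp
      show ?thesis unfolding upd
        by (rule common_link_update_rtrancl[OF mX j' common_out_neighbour_rtrancl[OF con[OF j'] j' bj(2,1)]])
    next
      case False
      then show ?thesis unfolding upd using common_link_update[OF mX j bj(1)] by blast
    qed
    moreover have "mix ?j \<in> X" unfolding upd using mX bj j by (auto simp: PiE_iff extensional_def)
    ultimately show ?case using rtrancl_trans[OF IH] by blast
  qed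
  moreover have "mix t = b" using a b by (auto simp: mix_def fun_eq_iff PiE_iff extensional_def)
  ultimately show ?thesis by fastforce
qed

lemma arc_sharing_connected:
  assumes "(a, a') \<in> common_link\<^sup>*" "link a b" "link a' b'"
  shows "(((i, a), (i + 1, b)), ((i, a'), (i + 1, b'))) \<in> (arc_sharing D)\<^sup>*"
  using assms(1,3)
proof (induction arbitrary: b')
  case base
  then show ?case using assms(2) by (auto simp: arc_sharing_def parcs_D)
next
  case (step a' a'')
  then obtain c where c: "link a' c" "link a'' c" by (auto simp: common_link_def)
  have "(((i, a), (i + 1, b)), ((i, a'), (i + 1, c))) \<in> (arc_sharing D)\<^sup>*" using step.IH c by blast
  also have "(((i, a'), (i + 1, c)), ((i, a''), (i + 1, c))) \<in> arc_sharing D"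
    using c by (simp add: arc_sharing_def parcs_D)
  also have "(((i, a''), (i + 1, c)), ((i, a''), (i + 1, b'))) \<in> arc_sharing D"
    using c step.prems by (simp add: arc_sharing_def parcs_D)
  finally show ?case .
qed

lemma arc_sharing_same_time:
  assumes "(e, e') \<in> (arc_sharing D)\<^sup>*"
  shows "fst (fst e') = fst (fst e)"
  using assms by induction (auto simp: arc_sharing_def parcs_D')

text \<open>
  Every vertex of time \<open>i\<close> has an out-neighbour and every vertex of time \<open>i + 1\<close> an in-neighbour, so
  the class has no fewer vertices than the induced subgraph.
\<close>

lemma arc_class_D:
  assumes con: "\<And>j. j \<in> {1..<t} \<Longrightarrow> Digraph_Component.connected (with_proj T \<restriction> (A j \<union> A (Suc j)))"
    and e: "link a b"
  shows "with_proj (arc_class_digraph D ((i, a), (i + 1, b))) = with_proj D \<restriction> ({i, i + 1} \<times> X)"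
proof -
  let ?e = "((i, a), (i + 1, b))"
  have eD: "?e \<in> parcs D" using e by (simp add: parcs_D)
  have aX: "a \<in> X" using e by (simp add: link_def)
  have C: "reachability_rel D `` {?e} = {((i, a'), (i + 1, b')) | a' b'. link a' b'}" (is "?C = ?L")
  proof (intro subset_antisym subsetI)
    fix e' assume "e' \<in> ?C"
    then have r: "(?e, e') \<in> reachability_rel D" by simp
    then have "fst (fst e') = i"
      using arc_sharing_same_time[of ?e e'] by (simp add: reachability_rel_iff_rtrancl[OF wf_D eD])
    then show "e' \<in> ?L" using reachability_rel_subset(2)[OF r] by (auto simp: parcs_D')
  next
    fix e' assume "e' \<in> ?L"
    then obtain a' b' where e': "e' = ((i, a'), (i + 1, b'))" "link a' b'" by blast
    then have "(a, a') \<in> common_link\<^sup>*" using common_link_connected[OF con aX] by (simp add: link_def)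
    then show "e' \<in> ?C"
      using arc_sharing_connected[OF _ e e'(2)] by (simp add: e' reachability_rel_iff_rtrancl[OF wf_D eD])
  qed
  have "fst ` ?L \<union> snd ` ?L = {i, i + 1} \<times> X"
  proof (intro subset_antisym subsetI)
    fix v assume "v \<in> fst ` ?L \<union> snd ` ?L"
    then show "v \<in> {i, i + 1} \<times> X" by (auto simp: link_def)
  next
    fix v assume "v \<in> {i, i + 1} \<times> X"
    then obtain k c where v: "v = (k, c)" "k = i \<or> k = i + 1" "c \<in> X" by auto
    obtain x y where "link c x" "link y c" using link_out link_in v(3) by blast
    then have "((i, c), (i + 1, x)) \<in> ?L" "((i, y), (i + 1, c)) \<in> ?L" by auto
    then show "v \<in> fst ` ?L \<union> snd ` ?L" using v(1,2) by force
  qed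
  moreover have "?L = {e \<in> parcs D. fst e \<in> {i, i + 1} \<times> X \<and> snd e \<in> {i, i + 1} \<times> X}"
    by (auto simp: parcs_D' link_def)
  ultimately show ?thesis
    by (simp add: arc_class_digraph_def Let_def C induce_subgraph_def with_proj_def)
qed

theorem reachability_digraph_D:
  assumes con: "\<And>j. j \<in> {1..<t} \<Longrightarrow> Digraph_Component.connected (with_proj T \<restriction> (A j \<union> A (Suc j)))"
    and tr: "s_arc_transitive T (t - 1)"
  shows "digraph_iso (with_proj (reachability_digraph D)) (with_proj D \<restriction> ({0, 1} \<times> X))"
proof -
  have "X \<noteq> {}" using nonempty by (auto simp: PiE_eq_empty_iff)
  then obtain a b where ab: "link a b" using link_out by blast
  have "s_arc_transitive D 1"
    using highly_arc_transitive_D[OF tr] by (simp add: highly_arc_transitive_def)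
  moreover have "((0, a), (1, b)) \<in> parcs D" using ab by (simp add: parcs_D)
  ultimately have "digraph_iso (with_proj (reachability_digraph D))
      (with_proj (arc_class_digraph D ((0, a), (1, b))))"
    by (rule reachability_digraph_iso[OF wf_D])
  then show ?thesis using arc_class_D[OF con ab, of 0] by simp
qed

end

section \<open>The structure of \<open>D(T)\<close>\<close>

theorem theorem3p2:
  fixes t :: nat
    and T :: "'a pair_pre_digraph"
    and A :: "nat \<Rightarrow> 'a set"
  assumes "t \<ge> 2"
    and "pair_loopfree_digraph T"
    and "s_arc_transitive T (t - 1)"
    and "pverts T = (\<Union>j\<in>{1..t}. A j)"
    and "disjoint_family_on A {1..t}"
    and "\<And>j. j \<in> {1..t} \<Longrightarrow> A j \<noteq> {}"
    and "\<And>u v. (u, v) \<in> parcs T \<Longrightarrow> \<exists>j\<in>{1..t-1}. u \<in> A j \<and> v \<in> A (j + 1)"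
    and "\<And>v. v \<in> pverts T - A 1 \<Longrightarrow> in_arcs (with_proj T) v \<noteq> {}"
    and "\<And>v. v \<in> pverts T - A t \<Longrightarrow> out_arcs (with_proj T) v \<noteq> {}"
  shows "Digraph_Component.connected (with_proj (level_digraph t A T))
    \<and> highly_arc_transitive (level_digraph t A T)
    \<and> ((\<forall>i\<in>{1..t-1}. Digraph_Component.connected (with_proj T \<restriction> (A i \<union> A (i + 1)))) \<longrightarrow>
        digraph_iso (with_proj (reachability_digraph (level_digraph t A T)))
          (with_proj (level_digraph t A T) \<restriction> ({0, 1} \<times> Pi\<^sub>E {1..t} A)))"
proof -
  have tm: "{1..t - 1} = {1..<t}" using assms(1) by auto
  interpret layered_digraph t T A
  proof
    show "2 \<le> t" "pverts T = (\<Union>j\<in>{1..t}. A j)" "disjoint_family_on A {1..t}" by fact+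
    show "A j \<noteq> {}" if "j \<in> {1..t}" for j using assms(6) that .
    show "\<exists>j\<in>{1..<t}. u \<in> A j \<and> v \<in> A (Suc j)" if "(u, v) \<in> parcs T" for u v
      using assms(7)[OF that] unfolding tm by simp
    have disj: "i = j" if "v \<in> A i" "v \<in> A j" "i \<in> {1..t}" "j \<in> {1..t}" for v i j
      using assms(5) that unfolding disjoint_family_on_def by blast
    show "\<exists>u. (u, v) \<in> parcs T" if "j \<in> {1..<t}" "v \<in> A (Suc j)" for j v
    proof -
      have "v \<in> pverts T - A 1" using that disj[of v "Suc j" 1] assms(4) by auto
      then show ?thesis using assms(8)[of v] by (auto simp: in_arcs_def)
    qed
    show "\<exists>v. (u, v) \<in> parcs T" if "j \<in> {1..<t}" "u \<in> A j" for j u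
    proof -
      have "u \<in> pverts T - A t" using that disj[of u j t] assms(4) by auto
      then show ?thesis using assms(9)[of u] by (auto simp: out_arcs_def)
    qed
  qed
  show ?thesis
    using connected_D highly_arc_transitive_D[OF assms(3)] reachability_digraph_D[OF _ assms(3)]
    unfolding tm by simp
qed

end
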